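(* Let $n\ge 1$ be an integer with prime factorization $n=\prod_{j=1}^r p_j^{s_j}$, where $p_1,\dots,p_r$ are distinct primes and $s_j\ge 1$. Let $m$ be an integer with $1\le m\le n$, written as $m=u\prod_{i=1}^r p_i^{t_i}$ with $t_i\ge 0$ and $\gcd(u,p_i)=1$ for $1\le i\le r$. Then \[ \sum_{k=1}^n \gcd(k,n)\, e^{-k\frac{2\pi i}{n}m} \;=\; \prod_{i=1}^r\Big[(\min(t_i,s_i)+1)\,\varphi(p_i^{s_i}) + \theta_{t_i,s_i}\, p_i^{s_i-1}\Big], \] where $\varphi$ is Euler's totient function.
   Context: For integers $t,s$, $\theta_{t,s}$ denotes the Heaviside step of $t-s$: $\theta_{t,s}=1$ if $t\ge s$ and $\theta_{t,s}=0$ if $t<s$. $\min(t,s)$ is the minimum of $t$ and $s$. An empty product equals $1$. *)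

theory Defs
  imports Complex_Main "HOL-Number_Theory.Totient"
begin

definition theta :: "int \<Rightarrow> int \<Rightarrow> nat" where
  "theta t s = (if t \<ge> s then 1 else 0)"

end

theory Submission
  imports Defs "HOL-Analysis.Complex_Transcendental"
begin

text \<open>
  Writing gcd(k, n) as the sum of \<phi>(d) over the common divisors d of k and n, the sum over
  the multiples k of d is a full sum of (n/d)-th roots of unity, equal to n/d if n/d divides m
  and to 0 otherwise. So the transform is the sum of e \<phi>(n/e) over the common divisors e
  of n and m. This is multiplicative in n, and for a prime power p^s every e = p^j with
  j < s contributes p^j \<phi>(p^(s-j)) = \<phi>(p^s), while e = p^s contributes
  p^s = \<phi>(p^s) + p^(s-1).
\<close>

text \<open>The condition \<open>e dvd m\<close> sits in the summand, so that the index set depends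
  on \<open>n\<close> alone and splits along coprime factors of \<open>n\<close>.\<close>

definition gcd_transform :: "nat \<Rightarrow> nat \<Rightarrow> nat" where
  "gcd_transform n m = (\<Sum>e | e dvd n. if e dvd m then e * totient (n div e) else 0)"

text \<open>Multiplication maps pairs of divisors bijectively onto the divisors of the product; the
  inverse is \<open>d\<close> to \<open>(gcd d a, gcd d b)\<close>.\<close>

lemma sum_divisors_mult_coprime:
  fixes a b :: nat and f :: "nat \<Rightarrow> 'a :: comm_monoid_add"
  assumes "coprime a b"
  shows "(\<Sum>d | d dvd a * b. f d) = (\<Sum>x | x dvd a. \<Sum>y | y dvd b. f (x * y))"
proof -
  have gcds: "gcd (x * y) a = x" "gcd (x * y) b = y" if "x dvd a" "y dvd b" for x y
  proof -
    have "coprime y a" "coprime x b"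
      using assms that by (meson coprime_commute coprime_divisors dvd_refl)+
    then show "gcd (x * y) a = x" "gcd (x * y) b = y"
      using that
      by (simp_all add: gcd_mult_right_right_cancel gcd_mult_left_right_cancel
          gcd_mult_left_left_cancel coprime_commute gcd_proj1_iff)
  qed
  have "bij_betw (\<lambda>(x, y). x * y) ({x. x dvd a} \<times> {y. y dvd b}) {d. d dvd a * b}"
    unfolding bij_betw_def
  proof
    show "inj_on (\<lambda>(x, y). x * y) ({x. x dvd a} \<times> {y. y dvd b})"
      by (rule inj_on_inverseI[where g = "\<lambda>d. (gcd d a, gcd d b)"]) (auto simp: gcds)
    show "(\<lambda>(x, y). x * y) ` ({x. x dvd a} \<times> {y. y dvd b}) = {d. d dvd a * b}"
    proof (intro equalityI subsetI)
      fix d assume "d \<in> {d. d dvd a * b}"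
      then obtain x y where "d = x * y" "x dvd a" "y dvd b"
        using division_decomp by blast
      then show "d \<in> (\<lambda>(x, y). x * y) ` ({x. x dvd a} \<times> {y. y dvd b})"
        by force
    qed (auto intro: mult_dvd_mono)
  qed
  from sum.reindex_bij_betw[OF this, of f] show ?thesis
    by (simp add: sum.cartesian_product case_prod_unfold)
qed

text \<open>Divisors \<open>x\<close>, \<open>y\<close> of \<open>a\<close>, \<open>b\<close> are
  coprime, and so are their cofactors; hence both the condition on \<open>m\<close> and the totient
  split, and each summand factors.\<close>

lemma gcd_transform_mult_coprime:
  assumes "coprime a b"
  shows "gcd_transform (a * b) m = gcd_transform a m * gcd_transform b m"
proof -
  have "(if x * y dvd m then x * y * totient (a * b div (x * y)) else 0) =
        (if x dvd m then x * totient (a div x) else 0) *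
        (if y dvd m then y * totient (b div y) else 0)"
    if "x dvd a" "y dvd b" for x y
  proof -
    have "x * y dvd m \<longleftrightarrow> x dvd m \<and> y dvd m"
      using coprime_divisors[OF that assms]
      by (meson divides_mult dvd_mult_left dvd_mult_right)
    moreover have "totient (a * b div (x * y)) = totient (a div x) * totient (b div y)"
      using assms that
      by (metis coprime_divisors div_dvd_div div_mult_div_if_dvd dvd_div_mult_self dvd_triv_left
          totient_mult_coprime)
    ultimately show ?thesis by simp
  qed
  then show ?thesis
    unfolding gcd_transform_def sum_divisors_mult_coprime[OF assms] sum_product
    by (intro sum.cong) auto
qed

text \<open>\<open>dvd_m\<close> makes \<open>t\<close> the exact exponent of \<open>p\<close> in
  \<open>m\<close>, so that the cofactor of \<open>p ^ t\<close> never enters.\<close>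

lemma gcd_transform_prime_power:
  assumes "prime p" "1 \<le> s" and dvd_m: "\<And>j. p ^ j dvd m \<longleftrightarrow> j \<le> t"
  shows "gcd_transform (p ^ s) m =
    (min t s + 1) * totient (p ^ s) + theta (int t) (int s) * p ^ (s - 1)"
proof -
  define g where "g j = (if j \<le> t then p ^ j * totient (p ^ (s - j)) else 0)" for j
  have p: "p > 1" using \<open>prime p\<close> by (rule prime_gt_1_nat)
  have "{e. e dvd p ^ s} = (\<lambda>j. p ^ j) ` {..s}"
    using divides_primepow_nat[OF \<open>prime p\<close>] by auto
  moreover have "inj_on (\<lambda>j. p ^ j) {..s}"
    using p by (auto simp: inj_on_def)
  ultimately have "gcd_transform (p ^ s) m =
      (\<Sum>j\<le>s. if p ^ j dvd m then p ^ j * totient (p ^ s div p ^ j) else 0)"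
    unfolding gcd_transform_def by (simp add: sum.reindex)
  also have "\<dots> = (\<Sum>j\<le>s. g j)"
    using p by (intro sum.cong) (auto simp: g_def dvd_m power_diff)
  \<comment> \<open>The top term is separate: \<open>totient (p ^ 0) = 1\<close> breaks the pattern
    \<open>p ^ j * totient (p ^ (s - j)) = totient (p ^ s)\<close>.\<close>
  also have "\<dots> = (\<Sum>j<s. g j) + g s"
    by (simp add: lessThan_Suc_atMost[symmetric])
  also have "(\<Sum>j<s. g j) = (\<Sum>j<s. if j \<le> t then totient (p ^ s) else 0)"
  proof (intro sum.cong refl)
    fix j assume "j \<in> {..<s}"
    then have "p ^ j * totient (p ^ (s - j)) = totient (p ^ s)"
      using \<open>prime p\<close> by (simp add: totient_prime_power mult.assoc[symmetric] power_add[symmetric])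
    then show "g j = (if j \<le> t then totient (p ^ s) else 0)" by (simp add: g_def)
  qed
  also have "\<dots> = card {j \<in> {..<s}. j \<le> t} * totient (p ^ s)"
    by (simp add: sum.inter_filter[symmetric])
  also have "{j \<in> {..<s}. j \<le> t} = {..<min (Suc t) s}" by auto
  finally have *: "gcd_transform (p ^ s) m = min (Suc t) s * totient (p ^ s) + g s" by simp
  \<comment> \<open>If \<open>t < s\<close>, then \<open>g s = 0\<close> and
    \<open>min (Suc t) s\<close> is already \<open>min t s + 1\<close>. Otherwise the count is one
    short, and \<open>g s = p ^ s\<close> supplies the missing \<open>totient (p ^ s)\<close>
    together with the theta term \<open>p ^ (s - 1)\<close>.\<close>
  have "p ^ (s - 1) * p = p ^ s"
    using \<open>1 \<le> s\<close> by (intro power_minus_mult) simp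
  moreover have "p ^ (s - 1) * p = p ^ (s - 1) * (p - 1) + p ^ (s - 1)"
    using p by (cases p) simp_all
  ultimately have "p ^ s = totient (p ^ s) + p ^ (s - 1)"
    using totient_prime_power[OF \<open>prime p\<close>, of s] \<open>1 \<le> s\<close> by linarith
  then show ?thesis
    unfolding * by (auto simp: g_def theta_def min_def)
qed

lemma gcd_transform_prod:
  assumes "finite A" and "\<And>i j. i \<in> A \<Longrightarrow> j \<in> A \<Longrightarrow> i \<noteq> j \<Longrightarrow> coprime (a i) (a j)"
  shows "gcd_transform (\<Prod>i\<in>A. a i) m = (\<Prod>i\<in>A. gcd_transform (a i) m)"
  using assms
proof (induction A rule: finite_induct)
  case empty
  then show ?case by (simp add: gcd_transform_def)
next
  case (insert x A)
  have "coprime (a x) (\<Prod>i\<in>A. a i)"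
    using insert by (intro prod_coprime_right) auto
  with insert show ?case by (simp add: gcd_transform_mult_coprime)
qed

text \<open>A geometric sum: the ratio \<open>inverse w\<close> is an \<open>n\<close>-th root of
  unity, equal to 1 exactly when \<open>n dvd m\<close>. The inverse accounts for the minus sign in
  the exponent of the transform.\<close>

lemma sum_root_unity:
  fixes n m :: nat
  assumes "n \<ge> 1"
  defines "w \<equiv> exp (2 * of_real pi * \<i> * of_nat m / of_nat n) :: complex"
  shows "(\<Sum>k=1..n. inverse w ^ k) = (if n dvd m then of_nat n else 0)"
proof -
  have w1: "inverse w = 1 \<longleftrightarrow> n dvd m"
    using complex_root_unity_eq_1[OF assms(1), of m] by (simp add: w_def)
  have "w ^ n = exp (2 * of_real pi * \<i> * of_nat m / of_nat 1)"
    unfolding w_def exp_of_nat_mult[symmetric] using assms(1) by simp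
  \<comment> \<open>The same criterion with denominator 1, which divides every
    \<open>m\<close>.\<close>
  also have "\<dots> = 1"
    using complex_root_unity_eq_1[of 1 m] by simp
  finally have wn: "inverse w ^ n = 1" by (simp add: power_inverse)
  have "(\<Sum>k=1..n. inverse w ^ k) = (\<Sum>k<n. inverse w ^ Suc k)"
    using sum.atLeast1_atMost_eq[of "\<lambda>k. inverse w ^ k" n] by simp
  also have "\<dots> = inverse w * (\<Sum>k<n. inverse w ^ k)"
    by (simp add: sum_distrib_left)
  finally show ?thesis
    using w1 wn by (simp add: sum_gp_strict)
qed

text \<open>Gauss's identity for the sum of totients over divisors, applied to
  \<open>gcd k n\<close>, followed by an exchange of sums.\<close>

lemma sum_gcd_eq_sum_divisors:
  fixes n :: nat and f :: "nat \<Rightarrow> complex"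
  assumes "n \<ge> 1"
  shows "(\<Sum>k=1..n. of_nat (gcd k n) * f k) =
    (\<Sum>d | d dvd n. of_nat (totient d) * (\<Sum>j=1..n div d. f (d * j)))"
proof -
  have fin: "finite {d. d dvd n}" using assms by simp
  have "(\<Sum>k=1..n. of_nat (gcd k n) * f k) =
      (\<Sum>k=1..n. \<Sum>d | d dvd n. if d dvd k then of_nat (totient d) * f k else 0)"
  proof (intro sum.cong refl)
    fix k
    have "gcd k n = (\<Sum>d | d dvd gcd k n. totient d)" by (rule totient_divisor_sum[symmetric])
    also have "{d. d dvd gcd k n} = {d \<in> {d. d dvd n}. d dvd k}" by auto
    finally have "of_nat (gcd k n) * f k =
        (\<Sum>d \<in> {d \<in> {d. d dvd n}. d dvd k}. of_nat (totient d) * f k)"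
      by (simp add: sum_distrib_right)
    \<comment> \<open>Moving \<open>d dvd k\<close> into the summand frees the range of
      \<open>d\<close> from \<open>k\<close>, so that the sums can be exchanged.\<close>
    then show "of_nat (gcd k n) * f k =
        (\<Sum>d | d dvd n. if d dvd k then of_nat (totient d) * f k else 0)"
      by (simp only: sum.inter_filter[OF fin])
  qed
  also have "\<dots> = (\<Sum>d | d dvd n. \<Sum>k=1..n. if d dvd k then of_nat (totient d) * f k else 0)"
    by (rule sum.swap)
  also have "\<dots> = (\<Sum>d | d dvd n. of_nat (totient d) * (\<Sum>j=1..n div d. f (d * j)))"
  proof (intro sum.cong refl)
    fix d assume "d \<in> {d. d dvd n}"
    then obtain e where n: "n = d * e" by auto
    with assms have d: "d > 0" by (cases d) auto
    have "(\<Sum>k=1..n. if d dvd k then of_nat (totient d) * f k else 0) =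
        (\<Sum>k \<in> {k \<in> {1..n}. d dvd k}. of_nat (totient d) * f k)"
      by (rule sum.inter_filter[symmetric]) simp
    also have "\<dots> = (\<Sum>j=1..e. of_nat (totient d) * f (d * j))"
      by (rule sum.reindex_bij_witness[where i = "\<lambda>j. d * j" and j = "\<lambda>k. k div d"])
        (use d in \<open>auto simp: n elim!: dvdE\<close>)
    finally show "(\<Sum>k=1..n. if d dvd k then of_nat (totient d) * f k else 0) =
        of_nat (totient d) * (\<Sum>j=1..n div d. f (d * j))"
      using d by (simp add: n sum_distrib_left)
  qed
  finally show ?thesis .
qed

lemma sum_gcd_exp_eq_gcd_transform:
  fixes n m :: nat
  assumes "n \<ge> 1"
  shows "(\<Sum>k=1..n. of_nat (gcd k n) *
      exp (- of_nat k * (2 * of_real pi * \<i> / of_nat n) * of_nat m)) =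
    (of_nat (gcd_transform n m) :: complex)"
proof -
  define f where "f k = exp (- of_nat k * (2 * of_real pi * \<i> / of_nat n) * of_nat m)" for k
  have "(\<Sum>j=1..n div d. f (d * j)) = (if n div d dvd m then of_nat (n div d) else 0)"
    if "d dvd n" for d
  proof -
    from that obtain e where n: "n = d * e" by auto
    with assms have "d > 0" "e \<ge> 1" by (cases d; cases e; auto)+
    \<comment> \<open>The factor \<open>d\<close> cancels against \<open>n = d * e\<close>, leaving
      powers of an \<open>e\<close>-th root of unity.\<close>
    have "f (d * j) = inverse (exp (2 * of_real pi * \<i> * of_nat m / of_nat e)) ^ j" for j
      unfolding f_def power_inverse exp_of_nat_mult[symmetric] exp_minus[symmetric] n
      using \<open>d > 0\<close> \<open>e \<ge> 1\<close> by (simp add: field_simps)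
    then show ?thesis
      using sum_root_unity[OF \<open>e \<ge> 1\<close>, of m] \<open>d > 0\<close> by (simp add: n)
  qed
  then have "(\<Sum>k=1..n. of_nat (gcd k n) * f k) =
      of_nat (\<Sum>d | d dvd n. totient d * (if n div d dvd m then n div d else 0))"
    unfolding sum_gcd_eq_sum_divisors[OF assms] of_nat_sum
    by (intro sum.cong) auto
  \<comment> \<open>Passing to the complementary divisor, \<open>e = n div d\<close>, is an
    involution on the divisors of \<open>n\<close>.\<close>
  also have "(\<Sum>d | d dvd n. totient d * (if n div d dvd m then n div d else 0)) =
      gcd_transform n m"
    unfolding gcd_transform_def
    by (rule sum.reindex_bij_witness[where i = "\<lambda>e. n div e" and j = "\<lambda>d. n div d"])
      (use assms in \<open>auto elim!: dvdE\<close>)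
  finally show ?thesis by (simp add: f_def)
qed

theorem theorem1:
  fixes n m r u :: nat and p s t :: "nat \<Rightarrow> nat"
  assumes "n \<ge> 1"
    and "\<And>j. j \<in> {1..r} \<Longrightarrow> prime (p j)"
    and "inj_on p {1..r}"
    and "\<And>j. j \<in> {1..r} \<Longrightarrow> s j \<ge> 1"
    and "n = (\<Prod>j=1..r. p j ^ s j)"
    and "1 \<le> m" and "m \<le> n"
    and "m = u * (\<Prod>i=1..r. p i ^ t i)"
    and "\<And>i. i \<in> {1..r} \<Longrightarrow> gcd u (p i) = 1"
  shows "(\<Sum>k=1..n. of_nat (gcd k n) * exp (- of_nat k * (2 * of_real pi * \<i> / of_nat n) * of_nat m))
       = (of_nat (\<Prod>i=1..r. (min (t i) (s i) + 1) * totient (p i ^ s i)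
                              + theta (int (t i)) (int (s i)) * p i ^ (s i - 1)) :: complex)"
proof -
  have coprime_p: "coprime (p i) (p j)" if "i \<in> {1..r}" "j \<in> {1..r}" "i \<noteq> j" for i j
    using that assms(2,3) by (intro primes_coprime) (auto dest: inj_onD)
  have dvd_m: "p i ^ j dvd m \<longleftrightarrow> j \<le> t i" if i: "i \<in> {1..r}" for i j
  proof -
    \<comment> \<open>The part of \<open>m\<close> prime to \<open>p i\<close>: with it split off,
      only \<open>p i ^ t i\<close> decides divisibility by powers of \<open>p i\<close>.\<close>
    define c where "c = u * (\<Prod>k\<in>{1..r} - {i}. p k ^ t k)"
    have m: "m = p i ^ t i * c"
      unfolding assms(8) c_def prod.remove[OF finite_atLeastAtMost i] by (rule mult.left_commute)
    have "coprime (p i) c"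
      unfolding c_def coprime_mult_right_iff
    proof
      show "coprime (p i) u"
        using assms(9)[OF i] by (simp add: coprime_iff_gcd_eq_1 gcd.commute)
      show "coprime (p i) (\<Prod>k\<in>{1..r} - {i}. p k ^ t k)"
        using i coprime_p by (intro prod_coprime_right) auto
    qed
    then have "coprime (p i ^ j) c" by simp
    then have "p i ^ j dvd m \<longleftrightarrow> p i ^ j dvd p i ^ t i"
      unfolding m by (simp add: coprime_dvd_mult_left_iff)
    also have "\<dots> \<longleftrightarrow> j \<le> t i"
      using prime_gt_1_nat[OF assms(2)[OF i]] by (simp add: power_dvd_imp_le dvd_power_iff_le)
    finally show ?thesis .
  qed
  have "gcd_transform n m = (\<Prod>i=1..r. gcd_transform (p i ^ s i) m)"
    unfolding assms(5) using coprime_p by (intro gcd_transform_prod) auto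
  also have "\<dots> = (\<Prod>i=1..r. (min (t i) (s i) + 1) * totient (p i ^ s i)
                              + theta (int (t i)) (int (s i)) * p i ^ (s i - 1))"
    using assms(2,4) dvd_m by (intro prod.cong refl gcd_transform_prime_power) auto
  finally show ?thesis
    using sum_gcd_exp_eq_gcd_transform[OF assms(1), of m] by simp
qed

end
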